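(* For every on-line algorithm for the light-trail scheduling problem on a linear array with $n$ nodes, there exists a transmission sequence for which the on-line algorithm requires $\Omega(\log n)$ times as many wavelengths as the optimal off-line algorithm.
   Context: On-line light-trail scheduling. The network is a linear array of $n$ nodes, numbered consecutively from $0$. A transmission sequence is a sequence of events, each being the arrival of a transmission $[s,d]$ (nodes $s<d$) with bandwidth requirement in $(0,1]$, or the departure of a previously scheduled transmission, which releases its bandwidth. On each wavelength, shutters (ON/OFF) at the nodes divide the array into light-trails, which are the segments $[u,v]$ between consecutive OFF shutters (the shutters at the two end nodes are always OFF). An arriving transmission $[s,d]$ must be assigned to a light-trail $[u,v]$ with $u\le s<d\le v$; at any time the total bandwidth of the active transmissions assigned to a light-trail is at most $1$. Transmissions are not moved once assigned, and a light-trail is not modified while it carries active transmissions. There are two variations of the problem: splittable, in which a transmission may be divided into several transmissions with the same endpoints whose bandwidths sum to the original one, assigned to possibly different light-trails, and non-splittable, in which this is not allowed; the result is stated without restriction to one of them. An on-line algorithm makes assignments without knowing later events; an off-line algorithm is given the whole sequence at the beginning. The number of wavelengths required by an algorithm on a sequence is the maximum over time of the number of wavelengths in use; the optimal off-line algorithm minimizes this number. The constant implied in $\Omega(\log n)$ does not depend on the on-line algorithm. *)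

theory Defs
  imports Complex_Main
begin

datatype variation = Splittable | Nonsplittable

text \<open>A transmission is identified by the position of its arrival in the sequence, so
  \<open>Depart i\<close> is the departure of the whole transmission that arrived as event number \<open>i\<close>.\<close>

datatype event =
    Arrive (source: nat) (destination: nat) (requirement: real)
  | Depart nat

definition transmission_sequence :: "nat \<Rightarrow> event list \<Rightarrow> bool" where
  "transmission_sequence n \<sigma> \<longleftrightarrow>
     (\<forall>t < length \<sigma>. case \<sigma> ! t of
        Arrive s d b \<Rightarrow> s < d \<and> d < n \<and> 0 < b \<and> b \<le> 1
      | Depart i \<Rightarrow> i < t \<and> is_Arrive (\<sigma> ! i) \<and> Depart i \<notin> set (take t \<sigma>))"

text \<open>The transmissions that are active after the first \<open>t\<close> events.\<close>

definition active :: "event list \<Rightarrow> nat \<Rightarrow> nat set" where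
  "active \<sigma> t = {i. i < t \<and> i < length \<sigma> \<and> is_Arrive (\<sigma> ! i) \<and> Depart i \<notin> set (take t \<sigma>)}"

text \<open>A shutter setting of one wavelength is given by its set of OFF nodes.\<close>

definition valid_shutters :: "nat \<Rightarrow> nat set \<Rightarrow> bool" where
  "valid_shutters n F \<longleftrightarrow> F \<subseteq> {..<n} \<and> 0 \<in> F \<and> n - 1 \<in> F"

definition light_trail :: "nat set \<Rightarrow> nat \<Rightarrow> nat \<Rightarrow> bool" where
  "light_trail F u v \<longleftrightarrow> u \<in> F \<and> v \<in> F \<and> u < v \<and> (\<forall>x \<in> F. \<not> (u < x \<and> x < v))"

text \<open>A piece of a transmission, assigned to the segment from \<open>seg_left\<close> to \<open>seg_right\<close> on
  wavelength \<open>wave\<close>; an unsplit transmission consists of a single piece.\<close>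

record piece =
  wave :: nat
  seg_left :: nat
  seg_right :: nat
  bandwidth :: real

text \<open>The reaction to one event: the shutters of all wavelengths after the event and, if the event
  is an arrival, the assignment of the new transmission.  For departures the field \<open>pieces\<close> is
  never consulted.\<close>

record step =
  off_nodes :: "nat \<Rightarrow> nat set"
  pieces :: "piece list"

definition valid_assignment :: "variation \<Rightarrow> nat \<Rightarrow> nat \<Rightarrow> real \<Rightarrow> piece list \<Rightarrow> bool" where
  "valid_assignment V s d b ps \<longleftrightarrow>
     (\<forall>p \<in> set ps. seg_left p \<le> s \<and> d \<le> seg_right p \<and> 0 < bandwidth p) \<and>
     (\<Sum>p\<leftarrow>ps. bandwidth p) = b \<and>
     (V = Nonsplittable \<longrightarrow> length ps = 1)"

definition trail_load :: "event list \<Rightarrow> (nat \<Rightarrow> step) \<Rightarrow> nat \<Rightarrow> nat \<Rightarrow> nat \<Rightarrow> nat \<Rightarrow> real" where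
  "trail_load \<sigma> S t w u v =
     (\<Sum>i \<in> active \<sigma> t.
        \<Sum>p \<leftarrow> filter (\<lambda>p. wave p = w \<and> seg_left p = u \<and> seg_right p = v) (pieces (S i)).
          bandwidth p)"

text \<open>\<open>S t\<close> is the reaction to event number \<open>t\<close>.  The third conjunct requires that the segment of
  every piece is a light-trail when the piece is assigned and that it stays one, unmodified, as
  long as the piece is active.\<close>

definition valid_schedule :: "variation \<Rightarrow> nat \<Rightarrow> event list \<Rightarrow> (nat \<Rightarrow> step) \<Rightarrow> bool" where
  "valid_schedule V n \<sigma> S \<longleftrightarrow>
     (\<forall>t < length \<sigma>.
        (\<forall>w. valid_shutters n (off_nodes (S t) w)) \<and>
        (case \<sigma> ! t of
           Arrive s d b \<Rightarrow> valid_assignment V s d b (pieces (S t))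
         | Depart i \<Rightarrow> True) \<and>
        (\<forall>i \<in> active \<sigma> (Suc t). \<forall>p \<in> set (pieces (S i)).
           light_trail (off_nodes (S t) (wave p)) (seg_left p) (seg_right p)) \<and>
        (\<forall>w u v. light_trail (off_nodes (S t) w) u v \<longrightarrow> trail_load \<sigma> S (Suc t) w u v \<le> 1))"

definition wavelengths_in_use :: "event list \<Rightarrow> (nat \<Rightarrow> step) \<Rightarrow> nat \<Rightarrow> nat set" where
  "wavelengths_in_use \<sigma> S t = (\<Union>i \<in> active \<sigma> t. wave ` set (pieces (S i)))"

definition wavelengths_required :: "event list \<Rightarrow> (nat \<Rightarrow> step) \<Rightarrow> nat" where
  "wavelengths_required \<sigma> S = Max ((\<lambda>t. card (wavelengths_in_use \<sigma> S t)) ` {..length \<sigma>})"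

definition optimal_wavelengths :: "variation \<Rightarrow> nat \<Rightarrow> event list \<Rightarrow> nat" where
  "optimal_wavelengths V n \<sigma> =
     (LEAST k. \<exists>S. valid_schedule V n \<sigma> S \<and> wavelengths_required \<sigma> S = k)"

text \<open>A (deterministic) on-line algorithm maps the events seen so far, the last of which is the
  current one, to its reaction; it has to produce a valid schedule for every sequence.\<close>

type_synonym algorithm = "event list \<Rightarrow> step"

definition run :: "algorithm \<Rightarrow> event list \<Rightarrow> nat \<Rightarrow> step" where
  "run A \<sigma> t = A (take (Suc t) \<sigma>)"

definition online_algorithm :: "variation \<Rightarrow> nat \<Rightarrow> algorithm \<Rightarrow> bool" where
  "online_algorithm V n A \<longleftrightarrow>
     (\<forall>\<sigma>. transmission_sequence n \<sigma> \<longrightarrow> valid_schedule V n \<sigma> (run A \<sigma>))"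

end

theory Submission
  imports Defs
begin

text \<open>The adversary only uses transmissions of bandwidth 1 and works recursively: in a region of
  length \<open>2 ^ k\<close> it forces the potential \<open>\<Sum>\<^sub>w min 1 (x w)\<close> to be at least \<open>k / 2\<close>, where \<open>x w\<close> is the
  bandwidth which the active transmissions of the region occupy on wavelength \<open>w\<close>.  For \<open>k + 1\<close> it
  plays in the left and then in the right half, obtaining occupancies \<open>x\<close> and \<open>y\<close>, and considers
  a transmission that covers the left half.  If this uses \<open>z w > 0\<close> on wavelength \<open>w\<close>, it shares
  its light-trail with everything from the left half on \<open>w\<close>, so \<open>z w + x w \<le> 1\<close>.  Hence
  \<open>min 1 (x + y) + min 1 (z + y) \<ge> min 1 x + min 1 y + z\<close> on each wavelength, and the potential grows
  by \<open>1 / 2\<close> either by keeping both halves or by adding the cover and then removing everything else in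
  the left half.  Off-line two wavelengths suffice, with all transmissions that survive a phase on the
  same wavelength: if a cover is used, exchange the two wavelengths in the left half, so that the
  cover joins the survivors of the right half.\<close>

section \<open>Active transmissions\<close>

lemma finite_active [simp]: "finite (active \<sigma> t)"
  by (rule finite_subset[of _ "{..<t}"]) (auto simp: active_def)

lemma active_append: "t \<le> length \<sigma> \<Longrightarrow> active (\<sigma> @ \<tau>) t = active \<sigma> t"
  by (auto simp: active_def nth_append)

lemma active_append_old:
  assumes "i \<in> active (\<sigma> @ \<tau>) t" "length \<sigma> \<le> t" "i < length \<sigma>"
  shows "i \<in> active \<sigma> (length \<sigma>)"
  using assms by (auto simp: active_def nth_append)

lemma active_append_keep:
  assumes "\<And>i. Depart i \<in> set \<tau> \<Longrightarrow> length \<sigma> \<le> i" "length \<sigma> \<le> t" "i < length \<sigma>"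
  shows "i \<in> active (\<sigma> @ \<tau>) t \<longleftrightarrow> i \<in> active \<sigma> (length \<sigma>)"
proof -
  have "Depart i \<notin> set (take k \<tau>)" for k
    using assms(1,3) by (meson in_set_takeD not_less)
  then show ?thesis using assms(2,3) by (auto simp: active_def nth_append)
qed

lemma active_is_Arrive: "i \<in> active \<sigma> t \<Longrightarrow> is_Arrive (\<sigma> ! i)"
  and active_less_length: "i \<in> active \<sigma> t \<Longrightarrow> i < length \<sigma>"
  and active_less: "i \<in> active \<sigma> t \<Longrightarrow> i < t"
  by (auto simp: active_def)

lemma transmission_sequence_append1:
  "transmission_sequence n (\<sigma> @ [e]) \<longleftrightarrow> transmission_sequence n \<sigma> \<and>
     (case e of Arrive s d b \<Rightarrow> s < d \<and> d < n \<and> 0 < b \<and> b \<le> 1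
      | Depart i \<Rightarrow> i \<in> active \<sigma> (length \<sigma>))"
proof -
  define P where "P \<rho> t \<longleftrightarrow> (case \<rho> ! t of Arrive s d b \<Rightarrow> s < d \<and> d < n \<and> 0 < b \<and> b \<le> 1
    | Depart i \<Rightarrow> i < t \<and> is_Arrive (\<rho> ! i) \<and> Depart i \<notin> set (take t \<rho>))" for \<rho> t
  have ts: "transmission_sequence n \<rho> \<longleftrightarrow> (\<forall>t < length \<rho>. P \<rho> t)" for \<rho>
    by (simp add: transmission_sequence_def P_def)
  have old: "P (\<sigma> @ [e]) t \<longleftrightarrow> P \<sigma> t" if "t < length \<sigma>" for t
    using that unfolding P_def by (cases "\<sigma> ! t") (auto simp: nth_append)
  have new: "P (\<sigma> @ [e]) (length \<sigma>) \<longleftrightarrow>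
      (case e of Arrive s d b \<Rightarrow> s < d \<and> d < n \<and> 0 < b \<and> b \<le> 1
       | Depart i \<Rightarrow> i \<in> active \<sigma> (length \<sigma>))"
    unfolding P_def by (cases e) (auto simp: nth_append active_def)
  have "transmission_sequence n (\<sigma> @ [e]) \<longleftrightarrow>
      (\<forall>t < length \<sigma>. P (\<sigma> @ [e]) t) \<and> P (\<sigma> @ [e]) (length \<sigma>)"
    unfolding ts by (auto simp: less_Suc_eq)
  then show ?thesis unfolding new by (simp add: ts old)
qed

lemma active_append_Arrive:
  assumes "transmission_sequence n \<sigma>"
  shows "active (\<sigma> @ [Arrive s d b]) (Suc (length \<sigma>)) = insert (length \<sigma>) (active \<sigma> (length \<sigma>))"
proof -
  \<comment> \<open>A departure names an earlier position, so none in \<open>\<sigma>\<close> can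
    name the position that the arrival is about to take. Otherwise the new transmission would count
    as departed from the start.\<close>
  have "Depart (length \<sigma>) \<notin> set \<sigma>"
  proof
    assume "Depart (length \<sigma>) \<in> set \<sigma>"
    then obtain t where t: "t < length \<sigma>" "\<sigma> ! t = Depart (length \<sigma>)"
      by (auto simp: in_set_conv_nth)
    with assms have "length \<sigma> < t" by (fastforce simp: transmission_sequence_def)
    with t(1) show False by simp
  qed
  then show ?thesis by (auto simp: active_def nth_append less_Suc_eq)
qed

lemma departures:
  assumes "transmission_sequence n \<sigma>" "distinct is" "set is \<subseteq> active \<sigma> (length \<sigma>)"
  shows "transmission_sequence n (\<sigma> @ map Depart is) \<and>
    active (\<sigma> @ map Depart is) (length (\<sigma> @ map Depart is)) = active \<sigma> (length \<sigma>) - set is"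
  using assms(2,3)
proof (induction "is" rule: rev_induct)
  case Nil
  then show ?case using assms(1) by simp
next
  case (snoc i js)
  let ?\<rho> = "\<sigma> @ map Depart js"
  have IH: "transmission_sequence n ?\<rho>"
      "active ?\<rho> (length ?\<rho>) = active \<sigma> (length \<sigma>) - set js"
    using snoc by auto
  have "transmission_sequence n (?\<rho> @ [Depart i])"
    unfolding transmission_sequence_append1 using IH snoc.prems by auto
  moreover have "active (?\<rho> @ [Depart i]) (length (?\<rho> @ [Depart i])) = active ?\<rho> (length ?\<rho>) - {i}"
    by (auto simp: active_def nth_append)
  ultimately show ?case using IH(2) by auto
qed

lemma transmission_sequence_Arrive:
  assumes "transmission_sequence n \<sigma>" "i < length \<sigma>" "is_Arrive (\<sigma> ! i)"
  shows "source (\<sigma> ! i) < destination (\<sigma> ! i)" "destination (\<sigma> ! i) < n"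
    "0 < requirement (\<sigma> ! i)" "requirement (\<sigma> ! i) \<le> 1"
proof -
  have "case \<sigma> ! i of Arrive s d b \<Rightarrow> s < d \<and> d < n \<and> 0 < b \<and> b \<le> 1
    | Depart j \<Rightarrow> j < i \<and> is_Arrive (\<sigma> ! j) \<and> Depart j \<notin> set (take i \<sigma>)"
    using assms(1,2) unfolding transmission_sequence_def by blast
  then show "source (\<sigma> ! i) < destination (\<sigma> ! i)" "destination (\<sigma> ! i) < n"
    "0 < requirement (\<sigma> ! i)" "requirement (\<sigma> ! i) \<le> 1"
    using assms(3) by (cases "\<sigma> ! i"; simp)+
qed

section \<open>Off-line schedules from colourings\<close>

text \<open>A common end node is allowed, since neighbouring light-trails of one wavelength meet at
  an OFF shutter.\<close>

definition apart :: "event \<Rightarrow> event \<Rightarrow> bool" where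
  "apart e f \<longleftrightarrow> destination e \<le> source f \<or> destination f \<le> source e"

lemma apart_commute: "apart e f \<longleftrightarrow> apart f e"
  by (auto simp: apart_def)

text \<open>A colour class is meant to fit on one wavelength. The bound \<open>m\<close> restricts
  attention to the transmissions of the current phase. The colour type is left open because the
  recursion uses truth values and the schedule uses wavelength numbers.\<close>

definition proper_colouring :: "event list \<Rightarrow> nat \<Rightarrow> (nat \<Rightarrow> 'c) \<Rightarrow> bool" where
  "proper_colouring \<sigma> m c \<longleftrightarrow>
     (\<forall>t. \<forall>i \<in> active \<sigma> t. \<forall>j \<in> active \<sigma> t.
        m \<le> i \<and> m \<le> j \<and> i \<noteq> j \<and> c i = c j \<longrightarrow> apart (\<sigma> ! i) (\<sigma> ! j))"

text \<open>Two old transmissions that are both active later were both active at the end of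
  \<open>\<sigma>\<close> already, where the given colouring separates them. So only pairs whose
  later member is new have to be checked.\<close>

lemma proper_colouring_appendI:
  assumes "proper_colouring \<sigma> m c"
    and new: "\<And>t i j. length \<sigma> < t \<Longrightarrow> i \<in> active (\<sigma> @ \<tau>) t \<Longrightarrow> j \<in> active (\<sigma> @ \<tau>) t \<Longrightarrow> m \<le> i \<Longrightarrow>
        i < j \<Longrightarrow> length \<sigma> \<le> j \<Longrightarrow> c i = c j \<Longrightarrow> apart ((\<sigma> @ \<tau>) ! i) ((\<sigma> @ \<tau>) ! j)"
  shows "proper_colouring (\<sigma> @ \<tau>) m c"
proof -
  have *: "apart ((\<sigma> @ \<tau>) ! i) ((\<sigma> @ \<tau>) ! j)"
    if a: "i \<in> active (\<sigma> @ \<tau>) t" "j \<in> active (\<sigma> @ \<tau>) t" "m \<le> i" "i < j" "c i = c j" for t i j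
  proof (cases "length \<sigma> < t \<and> length \<sigma> \<le> j")
    case True
    then show ?thesis using new a by blast
  next
    case False
    then have j: "j < length \<sigma>" using active_less[OF a(2)] by auto
    obtain t' where "i \<in> active \<sigma> t'" "j \<in> active \<sigma> t'"
    proof (cases "t \<le> length \<sigma>")
      case True
      then show ?thesis using a(1,2) that[of t] by (simp add: active_append)
    next
      case False
      then show ?thesis
        using that[of "length \<sigma>"] active_append_old[OF a(1)] active_append_old[OF a(2)] a(4) j by simp
    qed
    with assms(1) a j show ?thesis
      by (auto simp: proper_colouring_def nth_append)
  qed
  show ?thesis
    unfolding proper_colouring_def
  proof (intro allI ballI impI)
    fix t i j
    assume a: "i \<in> active (\<sigma> @ \<tau>) t" "j \<in> active (\<sigma> @ \<tau>) t"
      and "m \<le> i \<and> m \<le> j \<and> i \<noteq> j \<and> c i = c j"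
    then consider "i < j" "m \<le> i" "c i = c j" | "j < i" "m \<le> j" "c j = c i"
      by (metis linorder_neqE_nat)
    then show "apart ((\<sigma> @ \<tau>) ! i) ((\<sigma> @ \<tau>) ! j)"
    proof cases
      case 1
      then show ?thesis using * a by blast
    next
      case 2
      then show ?thesis using * a apart_commute by blast
    qed
  qed
qed

text \<open>The shutters are reset after every event so that each active transmission has a
  light-trail of its own, with exactly its endpoints.\<close>

definition coloured_schedule :: "nat \<Rightarrow> event list \<Rightarrow> (nat \<Rightarrow> nat) \<Rightarrow> nat \<Rightarrow> step" where
  "coloured_schedule n \<sigma> c t =
     \<lparr>off_nodes = \<lambda>w. {0, n - 1} \<union>
        (\<Union>i \<in> {i \<in> active \<sigma> (Suc t). c i = w}. {source (\<sigma> ! i), destination (\<sigma> ! i)}),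
      pieces = [\<lparr>wave = c t, seg_left = source (\<sigma> ! t), seg_right = destination (\<sigma> ! t),
        bandwidth = requirement (\<sigma> ! t)\<rparr>]\<rparr>"

text \<open>Transmissions of one colour are apart, so no OFF node falls strictly inside an active
  one, and its segment stays a light-trail while other shutters move. Each transmission is a single
  piece, which suits both variations.\<close>

lemma valid_coloured_schedule:
  assumes ts: "transmission_sequence n \<sigma>" and col: "proper_colouring \<sigma> 0 c" and n: "0 < n"
  shows "valid_schedule V n \<sigma> (coloured_schedule n \<sigma> c)"
proof -
  let ?S = "coloured_schedule n \<sigma> c"
  have props: "source (\<sigma> ! i) < destination (\<sigma> ! i)" "destination (\<sigma> ! i) < n"
      "requirement (\<sigma> ! i) \<le> 1" "0 < requirement (\<sigma> ! i)" if "i \<in> active \<sigma> t" for i t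
    using transmission_sequence_Arrive[OF ts active_less_length[OF that] active_is_Arrive[OF that]]
    by auto
  have apart: "apart (\<sigma> ! i) (\<sigma> ! j)"
    if "i \<in> active \<sigma> t" "j \<in> active \<sigma> t" "i \<noteq> j" "c i = c j" for i j t
    using col that by (auto simp: proper_colouring_def)
  have shutters: "valid_shutters n (off_nodes (?S t) w)" for t w
  proof -
    have "source (\<sigma> ! i) < n" "destination (\<sigma> ! i) < n" if "i \<in> active \<sigma> (Suc t)" for i
      using props[OF that] by auto
    then show ?thesis using n by (auto simp: valid_shutters_def coloured_schedule_def)
  qed
  have assignment: "case \<sigma> ! t of Arrive s d b \<Rightarrow> valid_assignment V s d b (pieces (?S t))
      | Depart i \<Rightarrow> True" if "t < length \<sigma>" for t
    using transmission_sequence_Arrive(3)[OF ts that]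
    by (auto simp: coloured_schedule_def valid_assignment_def split: event.split)
  have trail: "light_trail (off_nodes (?S t) (wave p)) (seg_left p) (seg_right p)"
    if i: "i \<in> active \<sigma> (Suc t)" and p: "p \<in> set (pieces (?S i))" for t i p
  proof -
    have "\<not> (source (\<sigma> ! i) < x \<and> x < destination (\<sigma> ! i))"
      if x: "x \<in> off_nodes (?S t) (c i)" for x
    proof -
      consider "x = 0" | "x = n - 1"
        | j where "j \<in> active \<sigma> (Suc t)" "c j = c i" "x = source (\<sigma> ! j) \<or> x = destination (\<sigma> ! j)"
        using x by (auto simp: coloured_schedule_def)
      then show ?thesis
      proof cases
        case 3
        then show ?thesis
          using props(1)[OF i] props(1)[OF 3(1)] apart[OF i 3(1)]
          by (cases "i = j") (auto simp: apart_def)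
      qed (use props(2)[OF i] in auto)
    qed
    then show ?thesis
      using i p props(1)[OF i] by (auto simp: light_trail_def coloured_schedule_def)
  qed
  have load: "trail_load \<sigma> ?S t w u v \<le> 1" for t w u v
  proof -
    let ?l = "\<lambda>i. if c i = w \<and> source (\<sigma> ! i) = u \<and> destination (\<sigma> ! i) = v
      then requirement (\<sigma> ! i) else 0"
    have eq: "trail_load \<sigma> ?S t w u v = (\<Sum>i \<in> active \<sigma> t. ?l i)"
      unfolding trail_load_def by (intro sum.cong) (auto simp: coloured_schedule_def)
    \<comment> \<open>Two active transmissions of the same colour and endpoints would not be apart.
      So at most one term of the sum is nonzero, and it is a requirement of at most 1.\<close>
    show ?thesis
    proof (cases "\<exists>i \<in> active \<sigma> t. c i = w \<and> source (\<sigma> ! i) = u \<and> destination (\<sigma> ! i) = v")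
      case True
      then obtain i where i: "i \<in> active \<sigma> t" "c i = w" "source (\<sigma> ! i) = u" "destination (\<sigma> ! i) = v"
        by blast
      have "?l j = 0" if "j \<in> active \<sigma> t - {i}" for j
        using that apart[OF i(1), of j] i props(1)[OF i(1)] by (auto simp: apart_def)
      then have "(\<Sum>j \<in> active \<sigma> t. ?l j) = ?l i"
        using i(1) by (subst sum.remove[of _ i]) auto
      then show ?thesis using eq props(3)[OF i(1)] by auto
    next
      case False
      then have "(\<Sum>i \<in> active \<sigma> t. ?l i) = 0" by (intro sum.neutral) auto
      then show ?thesis using eq by simp
    qed
  qed
  show ?thesis
    unfolding valid_schedule_def using shutters assignment trail load by blast
qed

lemma optimal_wavelengths_le_colours:
  assumes "transmission_sequence n \<sigma>" "proper_colouring \<sigma> 0 c" "0 < n" "\<And>i. c i < K"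
  shows "optimal_wavelengths V n \<sigma> \<le> K"
proof -
  let ?S = "coloured_schedule n \<sigma> c"
  have "card (wavelengths_in_use \<sigma> ?S t) \<le> K" for t
  proof -
    have "wavelengths_in_use \<sigma> ?S t \<subseteq> {..<K}"
      using assms(4) by (auto simp: wavelengths_in_use_def coloured_schedule_def)
    then show ?thesis using card_mono[of "{..<K}"] by fastforce
  qed
  then have "wavelengths_required \<sigma> ?S \<le> K"
    by (auto simp: wavelengths_required_def)
  moreover have "optimal_wavelengths V n \<sigma> \<le> wavelengths_required \<sigma> ?S"
    unfolding optimal_wavelengths_def
    using valid_coloured_schedule[OF assms(1-3)] by (intro Least_le) blast
  ultimately show ?thesis by simp
qed

section \<open>Occupancy of wavelengths\<close>

definition wave_load :: "(nat \<Rightarrow> step) \<Rightarrow> nat \<Rightarrow> nat \<Rightarrow> real" where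
  "wave_load S i w = (\<Sum>p \<leftarrow> filter (\<lambda>p. wave p = w) (pieces (S i)). bandwidth p)"

lemma wave_load_cong: "S i = S' i \<Longrightarrow> wave_load S i w = wave_load S' i w"
  by (simp add: wave_load_def)

lemma sum_list_by_wave:
  fixes f :: "piece \<Rightarrow> real"
  assumes "finite W" "wave ` set ps \<subseteq> W"
  shows "(\<Sum>w\<in>W. \<Sum>p \<leftarrow> filter (\<lambda>p. wave p = w) ps. f p) = (\<Sum>p\<leftarrow>ps. f p)"
  using assms(2)
proof (induction ps)
  case (Cons p ps)
  have "(\<Sum>w\<in>W. \<Sum>q \<leftarrow> filter (\<lambda>q. wave q = w) (p # ps). f q)
      = (\<Sum>w\<in>W. (if wave p = w then f p else 0) + (\<Sum>q \<leftarrow> filter (\<lambda>q. wave q = w) ps. f q))"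
    by (intro sum.cong) auto
  also have "\<dots> = f p + (\<Sum>q\<leftarrow>ps. f q)"
    using Cons assms(1) by (simp add: sum.distrib)
  finally show ?case by simp
qed simp

lemma valid_schedule_assignment:
  assumes "valid_schedule V n \<sigma> S" "i \<in> active \<sigma> t"
  shows "valid_assignment V (source (\<sigma> ! i)) (destination (\<sigma> ! i)) (requirement (\<sigma> ! i)) (pieces (S i))"
proof -
  have "case \<sigma> ! i of Arrive s d b \<Rightarrow> valid_assignment V s d b (pieces (S i)) | Depart _ \<Rightarrow> True"
    using assms(1) active_less_length[OF assms(2)] unfolding valid_schedule_def by blast
  then show ?thesis using active_is_Arrive[OF assms(2)] by (cases "\<sigma> ! i") auto
qed

lemma wave_load_nonneg:
  assumes "valid_schedule V n \<sigma> S" "i \<in> active \<sigma> t"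
  shows "0 \<le> wave_load S i w"
  using valid_schedule_assignment[OF assms]
  by (auto simp: wave_load_def valid_assignment_def less_imp_le intro!: sum_list_nonneg)

text \<open>If two overlapping light-trails differed, an end of one would be an OFF node strictly
  inside the other.\<close>

lemma light_trail_unique:
  assumes "light_trail F u v" "light_trail F u' v'" "u < v'" "u' < v"
  shows "u = u' \<and> v = v'"
proof -
  have "\<not> u < u'" "\<not> u' < u" "\<not> v < v'" "\<not> v' < v"
    using assms by (auto simp: light_trail_def)
  then show ?thesis by simp
qed

text \<open>A segment used by \<open>m\<close> contains every transmission of \<open>I\<close>, so
  any segment that such a transmission uses on the same wavelength overlaps it and must equal it.
  The capacity of this one light-trail then bounds everything.\<close>

lemma cover_shares_light_trails:
  assumes val: "valid_schedule V n \<sigma> S" and ts: "transmission_sequence n \<sigma>" and t: "t < length \<sigma>"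
    and m: "m \<in> active \<sigma> (Suc t)" and I: "I \<subseteq> active \<sigma> (Suc t) - {m}"
    and inside: "\<And>i. i \<in> I \<Longrightarrow>
      source (\<sigma> ! m) \<le> source (\<sigma> ! i) \<and> destination (\<sigma> ! i) \<le> destination (\<sigma> ! m)"
    and pos: "0 < wave_load S m w"
  shows "wave_load S m w + (\<Sum>i\<in>I. wave_load S i w) \<le> 1"
proof -
  let ?act = "active \<sigma> (Suc t)"
  have "filter (\<lambda>p. wave p = w) (pieces (S m)) \<noteq> []"
    using pos by (auto simp: wave_load_def)
  then obtain p where p: "p \<in> set (pieces (S m))" "wave p = w"
    by (auto simp: filter_empty_conv)
  let ?u = "seg_left p" and ?v = "seg_right p"
  let ?load = "\<lambda>i. \<Sum>q \<leftarrow> filter (\<lambda>q. wave q = w \<and> seg_left q = ?u \<and> seg_right q = ?v) (pieces (S i)).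
    bandwidth q"
  have trail: "light_trail (off_nodes (S t) (wave q)) (seg_left q) (seg_right q)"
    if "i \<in> ?act" "q \<in> set (pieces (S i))" for i q
    using val t that unfolding valid_schedule_def by blast
  have seg: "seg_left q \<le> source (\<sigma> ! i)" "destination (\<sigma> ! i) \<le> seg_right q"
    "0 < bandwidth q" if "i \<in> ?act" "q \<in> set (pieces (S i))" for i q
    using valid_schedule_assignment[OF val that(1)] that(2) by (auto simp: valid_assignment_def)
  \<comment> \<open>The case \<open>i = m\<close> matters too: if \<open>m\<close> is split, its
    pieces on \<open>w\<close> all share the light-trail of \<open>p\<close>.\<close>
  have same: "wave_load S i w = ?load i" if i: "i \<in> insert m I" for i
  proof -
    have act: "i \<in> ?act" using i m I by auto
    have lt: "source (\<sigma> ! i) < destination (\<sigma> ! i)"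
      using transmission_sequence_Arrive(1)[OF ts active_less_length[OF act] active_is_Arrive[OF act]] .
    have "seg_left q = ?u \<and> seg_right q = ?v" if q: "q \<in> set (pieces (S i))" "wave q = w" for q
    proof (rule light_trail_unique)
      show "light_trail (off_nodes (S t) w) (seg_left q) (seg_right q)"
        using trail[OF act q(1)] q(2) by simp
      show "light_trail (off_nodes (S t) w) ?u ?v"
        using trail[OF m p(1)] p(2) by simp
      show "seg_left q < ?v" "?u < seg_right q"
        using seg[OF act q(1)] seg[OF m p(1)] lt inside[of i] i by auto
    qed
    then have "filter (\<lambda>q. wave q = w) (pieces (S i))
      = filter (\<lambda>q. wave q = w \<and> seg_left q = ?u \<and> seg_right q = ?v) (pieces (S i))"
      by (intro filter_cong) auto
    then show ?thesis by (simp add: wave_load_def)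
  qed
  have fin: "finite I" by (rule finite_subset[OF I]) simp
  have "wave_load S m w + (\<Sum>i\<in>I. wave_load S i w) = (\<Sum>i\<in>insert m I. wave_load S i w)"
    using I fin by (subst sum.insert) auto
  also have "\<dots> = (\<Sum>i\<in>insert m I. ?load i)"
    using same by (intro sum.cong) auto
  also have "\<dots> \<le> (\<Sum>i\<in>?act. ?load i)"
    using I m seg(3) by (intro sum_mono2) (auto simp: less_imp_le intro!: sum_list_nonneg)
  also have "\<dots> = trail_load \<sigma> S (Suc t) w ?u ?v"
    by (simp add: trail_load_def)
  also have "\<dots> \<le> 1"
    using val t trail[OF m p(1)] p(2) unfolding valid_schedule_def by blast
  finally show ?thesis .
qed

text \<open>A lower bound on the potential. The finite witness \<open>W\<close> replaces a sum over
  all wavelengths; in a valid schedule the terms of active transmissions are nonnegative, so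
  enlarging \<open>W\<close> does no harm. Capping at 1 makes the potential a lower bound for the
  number of wavelengths in use.\<close>

definition occupies :: "(nat \<Rightarrow> step) \<Rightarrow> nat set \<Rightarrow> real \<Rightarrow> bool" where
  "occupies S I K \<longleftrightarrow> (\<exists>W. finite W \<and> K \<le> (\<Sum>w\<in>W. min 1 (\<Sum>i\<in>I. wave_load S i w)))"

lemma occupies_cong:
  assumes "\<And>i. i \<in> I \<Longrightarrow> S i = S' i"
  shows "occupies S I K \<longleftrightarrow> occupies S' I K"
proof -
  have "(\<Sum>i\<in>I. wave_load S i w) = (\<Sum>i\<in>I. wave_load S' i w)" for w
    using assms by (intro sum.cong) (auto intro: wave_load_cong)
  then show ?thesis by (simp add: occupies_def)
qed

lemma occupies_le_card:
  assumes "occupies S (active \<sigma> t) K"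
  shows "K \<le> real (card (wavelengths_in_use \<sigma> S t))"
proof -
  let ?U = "wavelengths_in_use \<sigma> S t"
  let ?g = "\<lambda>w. min 1 (\<Sum>i\<in>active \<sigma> t. wave_load S i w)"
  have fin: "finite ?U" by (auto simp: wavelengths_in_use_def)
  obtain W where W: "finite W" "K \<le> (\<Sum>w\<in>W. ?g w)"
    using assms by (auto simp: occupies_def)
  have "wave_load S i w = 0" if "i \<in> active \<sigma> t" "w \<notin> ?U" for i w
  proof -
    have "filter (\<lambda>p. wave p = w) (pieces (S i)) = []"
      using that by (auto simp: wavelengths_in_use_def filter_empty_conv)
    then show ?thesis by (simp add: wave_load_def)
  qed
  then have zero: "?g w = 0" if "w \<notin> ?U" for w using that by simp
  have "(\<Sum>w\<in>W. ?g w) = (\<Sum>w\<in>W \<inter> ?U. ?g w)"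
    using W(1) zero by (intro sum.mono_neutral_right) auto
  also have "\<dots> \<le> (\<Sum>w\<in>W \<inter> ?U. 1)" by (intro sum_mono) auto
  also have "\<dots> \<le> real (card ?U)" using fin by (auto intro: card_mono)
  finally show ?thesis using W(2) by simp
qed

text \<open>Summing the inequality per wavelength gives at least \<open>2 * K + 1\<close> for the
  two alternatives together, so one of them reaches half of that.\<close>

lemma potential_gain:
  fixes x y z :: "'a \<Rightarrow> real"
  assumes "\<And>w. w \<in> W \<Longrightarrow> 0 \<le> x w \<and> 0 \<le> y w \<and> 0 \<le> z w"
    and "\<And>w. w \<in> W \<Longrightarrow> 0 < z w \<Longrightarrow> z w + x w \<le> 1"
    and "1 \<le> (\<Sum>w\<in>W. z w)" "K \<le> (\<Sum>w\<in>W. min 1 (x w))" "K \<le> (\<Sum>w\<in>W. min 1 (y w))"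
  shows "K + 1/2 \<le> (\<Sum>w\<in>W. min 1 (x w + y w)) \<or> K + 1/2 \<le> (\<Sum>w\<in>W. min 1 (z w + y w))"
proof -
  have "(\<Sum>w\<in>W. min 1 (x w) + min 1 (y w) + z w) \<le> (\<Sum>w\<in>W. min 1 (x w + y w) + min 1 (z w + y w))"
  proof (rule sum_mono)
    \<comment> \<open>For \<open>z w = 0\<close> this is monotonicity of the cap. For
      \<open>z w > 0\<close> both \<open>x w\<close> and \<open>z w + x w\<close> are at most 1, and
      the inequality holds whichever of the minima are capped.\<close>
    fix w assume "w \<in> W"
    with assms(1,2)[OF this]
    show "min 1 (x w) + min 1 (y w) + z w \<le> min 1 (x w + y w) + min 1 (z w + y w)"
      by (cases "z w = 0") (auto simp: min_def)
  qed
  then show ?thesis using assms(3-5) by (auto simp: sum.distrib)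
qed

section \<open>The adversary\<close>

text \<open>A round \<open>\<tau>\<close> of the adversary after the history
  \<open>\<sigma>\<close>, confined to the region from \<open>a\<close> to \<open>b\<close> and
  ending only transmissions of its own. The truth values are the two off-line wavelengths, and the
  last conjunct is the invariant that all survivors have colour \<open>True\<close>.\<close>

definition phase :: "nat \<Rightarrow> nat \<Rightarrow> event list \<Rightarrow> event list \<Rightarrow> (nat \<Rightarrow> bool) \<Rightarrow> bool" where
  "phase a b \<sigma> \<tau> c \<longleftrightarrow>
     (\<forall>e \<in> set \<tau>. case e of Arrive s d r \<Rightarrow> a \<le> s \<and> d \<le> b | Depart i \<Rightarrow> length \<sigma> \<le> i) \<and>
     proper_colouring (\<sigma> @ \<tau>) (length \<sigma>) c \<and>
     (\<forall>i \<in> active (\<sigma> @ \<tau>) (length (\<sigma> @ \<tau>)). length \<sigma> \<le> i \<longrightarrow> c i)"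

definition phase_active :: "event list \<Rightarrow> event list \<Rightarrow> nat set" where
  "phase_active \<sigma> \<tau> = active (\<sigma> @ \<tau>) (length (\<sigma> @ \<tau>)) \<inter> {length \<sigma>..}"

lemma phase_event:
  assumes "phase a b \<sigma> \<tau> c" "e \<in> set \<tau>" "a' \<le> a" "b \<le> b'" "m \<le> length \<sigma>"
  shows "case e of Arrive s d r \<Rightarrow> a' \<le> s \<and> d \<le> b' | Depart i \<Rightarrow> m \<le> i"
proof -
  have "case e of Arrive s d r \<Rightarrow> a \<le> s \<and> d \<le> b | Depart i \<Rightarrow> length \<sigma> \<le> i"
    using assms(1,2) by (simp add: phase_def)
  with assms(3-5) show ?thesis by (cases e) auto
qed

lemma phase_location:
  assumes "phase a b \<sigma> \<tau> c" "length \<sigma> \<le> i" "i < length (\<sigma> @ \<tau>)" "is_Arrive ((\<sigma> @ \<tau>) ! i)"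
  shows "a \<le> source ((\<sigma> @ \<tau>) ! i)" "destination ((\<sigma> @ \<tau>) ! i) \<le> b"
proof -
  have "(\<sigma> @ \<tau>) ! i \<in> set \<tau>" using assms(2,3) by (auto simp: nth_append)
  then have "case (\<sigma> @ \<tau>) ! i of Arrive s d r \<Rightarrow> a \<le> s \<and> d \<le> b | Depart i \<Rightarrow> length \<sigma> \<le> i"
    using phase_event[OF assms(1)] by simp
  with assms(4) show "a \<le> source ((\<sigma> @ \<tau>) ! i)" "destination ((\<sigma> @ \<tau>) ! i) \<le> b"
    by (cases "(\<sigma> @ \<tau>) ! i"; simp)+
qed

lemma phase_Depart: "phase a b \<sigma> \<tau> c \<Longrightarrow> Depart i \<in> set \<tau> \<Longrightarrow> length \<sigma> \<le> i"
  using phase_event by fastforce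

lemma run_append: "i < length \<sigma> \<Longrightarrow> run A (\<sigma> @ \<tau>) i = run A \<sigma> i"
  by (simp add: run_def)

text \<open>Transmissions on different sides of \<open>h\<close> are apart whatever their colours,
  so the colours of the left phase can be kept (\<open>s = True\<close>) or exchanged
  (\<open>s = False\<close>) independently of the right phase.\<close>

lemma proper_colouring_two_phases:
  assumes L: "phase a h \<sigma> \<tau> c" and R: "phase h b (\<sigma> @ \<tau>) \<upsilon> d"
  shows "proper_colouring (\<sigma> @ \<tau> @ \<upsilon>) (length \<sigma>) (\<lambda>i. if i < length (\<sigma> @ \<tau>) then c i = s else d i)"
proof -
  let ?c = "\<lambda>i. if i < length (\<sigma> @ \<tau>) then c i = s else d i"
  have "proper_colouring (\<sigma> @ \<tau>) (length \<sigma>) ?c"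
    using L active_less_length unfolding phase_def proper_colouring_def by metis
  then have "proper_colouring ((\<sigma> @ \<tau>) @ \<upsilon>) (length \<sigma>) ?c"
  proof (rule proper_colouring_appendI)
    fix t i j
    assume t: "length (\<sigma> @ \<tau>) < t" and i: "i \<in> active ((\<sigma> @ \<tau>) @ \<upsilon>) t" and j: "j \<in> active ((\<sigma> @ \<tau>) @ \<upsilon>) t"
      and ij: "length \<sigma> \<le> i" "i < j" "length (\<sigma> @ \<tau>) \<le> j" "?c i = ?c j"
    show "apart (((\<sigma> @ \<tau>) @ \<upsilon>) ! i) (((\<sigma> @ \<tau>) @ \<upsilon>) ! j)"
    proof (cases "i < length (\<sigma> @ \<tau>)")
      case True
      have "i \<in> active (\<sigma> @ \<tau>) (length (\<sigma> @ \<tau>))"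
        using active_append_old[OF i _ True] t by simp
      then have "destination ((\<sigma> @ \<tau>) ! i) \<le> h"
        using phase_location(2)[OF L ij(1) True] active_is_Arrive by blast
      moreover have "h \<le> source (((\<sigma> @ \<tau>) @ \<upsilon>) ! j)"
        using phase_location(1)[OF R ij(3)] active_less_length[OF j] active_is_Arrive[OF j] by blast
      moreover have "((\<sigma> @ \<tau>) @ \<upsilon>) ! i = (\<sigma> @ \<tau>) ! i" using True by (rule nth_append_left)
      ultimately show ?thesis by (simp add: apart_def)
    next
      case False
      moreover have "proper_colouring ((\<sigma> @ \<tau>) @ \<upsilon>) (length (\<sigma> @ \<tau>)) d" using R by (simp add: phase_def)
      ultimately show ?thesis
        using i j ij unfolding proper_colouring_def
        by (metis (no_types, lifting) not_less order_less_imp_not_eq)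
    qed
  qed
  then show ?thesis by simp
qed

text \<open>The right phase ends only its own transmissions, so the survivors of the left one remain
  active.\<close>

lemma phase_active_two_phases:
  assumes R: "phase h b (\<sigma> @ \<tau>) \<upsilon> d"
  shows "phase_active \<sigma> (\<tau> @ \<upsilon>) = phase_active \<sigma> \<tau> \<union> phase_active (\<sigma> @ \<tau>) \<upsilon>"
    and "phase_active \<sigma> \<tau> \<inter> phase_active (\<sigma> @ \<tau>) \<upsilon> = {}"
proof -
  let ?\<rho> = "(\<sigma> @ \<tau>) @ \<upsilon>"
  have "i \<in> active ?\<rho> (length ?\<rho>) \<longleftrightarrow> i \<in> active (\<sigma> @ \<tau>) (length (\<sigma> @ \<tau>))" if "i < length (\<sigma> @ \<tau>)" for i
    using that phase_Depart[OF R] by (intro active_append_keep) auto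
  then show "phase_active \<sigma> (\<tau> @ \<upsilon>) = phase_active \<sigma> \<tau> \<union> phase_active (\<sigma> @ \<tau>) \<upsilon>"
    unfolding phase_active_def
    by (auto simp del: length_append simp: not_less dest: active_less_length)
      (auto simp: not_less dest: active_less_length)
  show "phase_active \<sigma> \<tau> \<inter> phase_active (\<sigma> @ \<tau>) \<upsilon> = {}"
    by (auto simp: phase_active_def dest: active_less_length)
qed

text \<open>\<open>potential_gain\<close> needs one set of wavelengths for both halves, which also
  has to contain the wavelengths of the cover; these enter as \<open>U\<close>.\<close>

lemma occupies_common_set:
  assumes "valid_schedule V n \<sigma> S" "I \<subseteq> active \<sigma> t" "J \<subseteq> active \<sigma> t" "finite U"
    "occupies S I K" "occupies S J K"
  obtains W where "finite W" "U \<subseteq> W" "K \<le> (\<Sum>w\<in>W. min 1 (\<Sum>i\<in>I. wave_load S i w))"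
    "K \<le> (\<Sum>w\<in>W. min 1 (\<Sum>i\<in>J. wave_load S i w))"
proof -
  obtain W1 W2 where W: "finite W1" "K \<le> (\<Sum>w\<in>W1. min 1 (\<Sum>i\<in>I. wave_load S i w))"
    "finite W2" "K \<le> (\<Sum>w\<in>W2. min 1 (\<Sum>i\<in>J. wave_load S i w))"
    using assms(5,6) by (auto simp: occupies_def)
  let ?W = "W1 \<union> W2 \<union> U"
  have nonneg: "0 \<le> min 1 (\<Sum>i\<in>I'. wave_load S i w)" if "I' \<subseteq> active \<sigma> t" for I' w
  proof -
    have "0 \<le> (\<Sum>i\<in>I'. wave_load S i w)"
      using that wave_load_nonneg[OF assms(1)] by (intro sum_nonneg) blast
    then show ?thesis by simp
  qed
  have mono: "(\<Sum>w\<in>W'. min 1 (\<Sum>i\<in>I'. wave_load S i w)) \<le> (\<Sum>w\<in>?W. min 1 (\<Sum>i\<in>I'. wave_load S i w))"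
    if "I' \<subseteq> active \<sigma> t" "W' \<subseteq> ?W" for I' W'
    using that W(1,3) assms(4) nonneg by (intro sum_mono2) auto
  show ?thesis
  proof (rule that[of ?W])
    show "K \<le> (\<Sum>w\<in>?W. min 1 (\<Sum>i\<in>I. wave_load S i w))"
      using W(2) mono[OF assms(2), of W1] by (rule order_trans) auto
    show "K \<le> (\<Sum>w\<in>?W. min 1 (\<Sum>i\<in>J. wave_load S i w))"
      using W(4) mono[OF assms(3), of W2] by (rule order_trans) auto
  qed (use W(1,3) assms(4) in auto)
qed

lemma phase_activeD:
  assumes "i \<in> phase_active \<sigma> \<tau>"
  shows "length \<sigma> \<le> i" "i < length (\<sigma> @ \<tau>)" "is_Arrive ((\<sigma> @ \<tau>) ! i)"
    "i \<in> active (\<sigma> @ \<tau>) (length (\<sigma> @ \<tau>))"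
  using assms by (auto simp: phase_active_def active_def)

lemma phase_keep_both:
  assumes L: "phase a h \<sigma> \<tau> c" and R: "phase h b (\<sigma> @ \<tau>) \<upsilon> d" and "a \<le> h" "h \<le> b"
  shows "\<exists>e. phase a b \<sigma> (\<tau> @ \<upsilon>) e"
proof -
  let ?e = "\<lambda>i. if i < length (\<sigma> @ \<tau>) then c i = True else d i"
  have "?e i" if "i \<in> phase_active \<sigma> (\<tau> @ \<upsilon>)" for i
    using that L R unfolding phase_active_two_phases(1)[OF R]
    by (auto simp: phase_active_def phase_def simp del: length_append dest: active_less_length)
  moreover have "case e of Arrive s d r \<Rightarrow> a \<le> s \<and> d \<le> b | Depart i \<Rightarrow> length \<sigma> \<le> i"
    if "e \<in> set (\<tau> @ \<upsilon>)" for e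
    using that phase_event[OF L] phase_event[OF R] assms(3,4) by auto
  ultimately have "phase a b \<sigma> (\<tau> @ \<upsilon>) ?e"
    using proper_colouring_two_phases[OF L R, of True]
    unfolding phase_def phase_active_def by auto
  then show ?thesis by blast
qed

text \<open>The cover arrives while the left survivors are still active, so that it has to share
  with them; only then do they depart.\<close>

lemma phase_cover:
  assumes L: "phase a h \<sigma> \<tau> c" and R: "phase h b (\<sigma> @ \<tau>) \<upsilon> d" and "a < h" "h \<le> b" "h < n"
    and ts: "transmission_sequence n (\<sigma> @ \<tau> @ \<upsilon>)"
  shows "\<exists>\<delta> e. transmission_sequence n (\<sigma> @ \<tau> @ \<upsilon> @ Arrive a h 1 # \<delta>) \<and>
    phase a b \<sigma> (\<tau> @ \<upsilon> @ Arrive a h 1 # \<delta>) e \<and>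
    phase_active \<sigma> (\<tau> @ \<upsilon> @ Arrive a h 1 # \<delta>)
      = insert (length (\<sigma> @ \<tau> @ \<upsilon>)) (phase_active (\<sigma> @ \<tau>) \<upsilon>)"
proof -
  define X where "X = phase_active \<sigma> \<tau>"
  define Y where "Y = phase_active (\<sigma> @ \<tau>) \<upsilon>"
  define \<rho> where "\<rho> = \<sigma> @ \<tau> @ \<upsilon>"
  define m where "m = length \<rho>"
  define \<rho>' where "\<rho>' = \<rho> @ [Arrive a h 1]"
  define \<delta> where "\<delta> = map Depart (sorted_list_of_set X)"
  \<comment> \<open>The exchange gives the left survivors colour \<open>False\<close>, which frees
    \<open>True\<close> for the cover at position \<open>m\<close>. After the departures only the
    cover and the right survivors remain, all of colour \<open>True\<close>.\<close>
  let ?e = "\<lambda>i. if i < m then (if i < length (\<sigma> @ \<tau>) then c i = False else d i) else True"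
  have XY: "active \<rho> m \<inter> {length \<sigma>..} = X \<union> Y" "X \<inter> Y = {}"
    using phase_active_two_phases[OF R]
    by (auto simp: X_def Y_def \<rho>_def m_def phase_active_def)
  have fin: "finite X" "finite Y" by (auto simp: X_def Y_def phase_active_def)
  have ts': "transmission_sequence n \<rho>'"
    using ts assms(3,5) by (simp add: \<rho>'_def \<rho>_def[symmetric] transmission_sequence_append1)
  have act': "active \<rho>' (length \<rho>') = insert m (active \<rho> m)"
    using active_append_Arrive[of n \<rho>] ts by (simp add: \<rho>'_def m_def \<rho>_def[symmetric])
  have dep: "transmission_sequence n (\<rho>' @ \<delta>)"
    "active (\<rho>' @ \<delta>) (length (\<rho>' @ \<delta>)) = insert m (active \<rho> m) - X"
    using departures[OF ts', of "sorted_list_of_set X"] act' XY fin by (auto simp: \<delta>_def)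
  have m: "m \<notin> X" "length \<sigma> \<le> m"
    using XY(1) active_less[of m \<rho> m] by (auto simp: m_def \<rho>_def)
  have survivors: "active (\<rho>' @ \<delta>) (length (\<rho>' @ \<delta>)) \<inter> {length \<sigma>..} = insert m Y"
    using XY m unfolding dep(2) by blast
  have "proper_colouring \<rho> (length \<sigma>) ?e"
    using proper_colouring_two_phases[OF L R, of False] active_less_length
    unfolding proper_colouring_def \<rho>_def m_def by (metis (no_types, lifting))
  then have col: "proper_colouring (\<rho> @ Arrive a h 1 # \<delta>) (length \<sigma>) ?e"
  proof (rule proper_colouring_appendI)
    fix t i j
    assume t: "length \<rho> < t" and i: "i \<in> active (\<rho> @ Arrive a h 1 # \<delta>) t"
      and j: "j \<in> active (\<rho> @ Arrive a h 1 # \<delta>) t"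
      and ij: "length \<sigma> \<le> i" "i < j" "length \<rho> \<le> j" "?e i = ?e j"
    \<comment> \<open>Beyond \<open>\<rho>\<close> the cover is the only arrival.\<close>
    have "j = m"
    proof (rule ccontr)
      assume "j \<noteq> m"
      then have "(\<rho> @ Arrive a h 1 # \<delta>) ! j \<in> set \<delta>"
        using ij(3) active_less_length[OF j] by (auto simp: nth_append m_def nth_Cons')
      then show False using active_is_Arrive[OF j] by (auto simp: \<delta>_def)
    qed
    then have im: "i < length \<rho>" using ij by (simp add: m_def)
    have ai: "i \<in> active \<rho> m"
      using active_append_old[OF i _ im] t by (simp add: m_def)
    then have "i \<in> X \<union> Y" using XY(1) ij(1) by auto
    \<comment> \<open>Left survivors now have the other colour, so a conflict with the cover could
      only come from \<open>Y\<close>, which lies to the right of \<open>h\<close>.\<close>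
    moreover have "i \<notin> X"
    proof
      assume "i \<in> X"
      then have "i < length (\<sigma> @ \<tau>)" "c i"
        using L phase_activeD[of i \<sigma> \<tau>] by (auto simp: X_def phase_def)
      then show False using ij(4) im \<open>j = m\<close> by (simp add: m_def)
    qed
    ultimately have "h \<le> source (\<rho> ! i)"
      using phase_location(1)[OF R] phase_activeD[of i "\<sigma> @ \<tau>" \<upsilon>] by (auto simp: Y_def \<rho>_def)
    then show "apart ((\<rho> @ Arrive a h 1 # \<delta>) ! i) ((\<rho> @ Arrive a h 1 # \<delta>) ! j)"
      using im \<open>j = m\<close> by (simp add: apart_def nth_append m_def)
  qed
  have event: "case e of Arrive s d r \<Rightarrow> a \<le> s \<and> d \<le> b | Depart i \<Rightarrow> length \<sigma> \<le> i"
    if e: "e \<in> set (\<tau> @ \<upsilon> @ Arrive a h 1 # \<delta>)" for e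
  proof -
    consider "e \<in> set \<tau>" | "e \<in> set \<upsilon>" | "e = Arrive a h 1" | "e \<in> set \<delta>" using e by auto
    then show ?thesis
    proof cases
      case 4
      then show ?thesis using phase_activeD(1)[of _ \<sigma> \<tau>] fin by (auto simp: \<delta>_def X_def)
    qed (use phase_event[OF L] phase_event[OF R] assms(3,4) in auto)
  qed
  have survive: "?e i" if "i \<in> active (\<rho>' @ \<delta>) (length (\<rho>' @ \<delta>))" "length \<sigma> \<le> i" for i
  proof -
    have "i \<in> insert m Y" using that survivors by blast
    then show ?thesis using R phase_activeD[of i "\<sigma> @ \<tau>" \<upsilon>] by (auto simp: Y_def phase_def)
  qed
  have eq: "\<sigma> @ \<tau> @ \<upsilon> @ Arrive a h 1 # \<delta> = \<rho>' @ \<delta>" "\<rho> @ Arrive a h 1 # \<delta> = \<rho>' @ \<delta>"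
    by (simp_all add: \<rho>'_def \<rho>_def)
  have "phase a b \<sigma> (\<tau> @ \<upsilon> @ Arrive a h 1 # \<delta>) ?e"
    unfolding phase_def eq(1) using col event survive unfolding eq(2)
    by (intro conjI ballI impI)
  moreover have "phase_active \<sigma> (\<tau> @ \<upsilon> @ Arrive a h 1 # \<delta>) = insert m Y"
    using survivors by (simp add: phase_active_def \<rho>'_def \<rho>_def)
  moreover have "transmission_sequence n (\<sigma> @ \<tau> @ \<upsilon> @ Arrive a h 1 # \<delta>)"
    using dep(1) by (simp add: \<rho>'_def \<rho>_def)
  ultimately show ?thesis unfolding Y_def m_def \<rho>_def by blast
qed

text \<open>The history \<open>\<sigma>\<close> and the left end \<open>a\<close> are generalised
  because the right half is played after, and beside, the left half.\<close>

lemma adversary: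
  assumes alg: "online_algorithm V n A"
  shows "transmission_sequence n \<sigma> \<Longrightarrow> a + 2 ^ k < n \<Longrightarrow>
    \<exists>\<tau> c. transmission_sequence n (\<sigma> @ \<tau>) \<and> phase a (a + 2 ^ k) \<sigma> \<tau> c \<and>
      occupies (run A (\<sigma> @ \<tau>)) (phase_active \<sigma> \<tau>) (real k / 2)"
proof (induction k arbitrary: a \<sigma>)
  case 0
  have "phase a (a + 2 ^ 0) \<sigma> [] (\<lambda>_. True)"
    by (auto simp: phase_def proper_colouring_def dest: active_less_length)
  moreover have "occupies S I 0" for S I
    unfolding occupies_def by (rule exI[of _ "{}"]) simp
  ultimately show ?case using 0 by (intro exI[of _ "[]"]) auto
next
  case (Suc k)
  define h where "h = a + 2 ^ k"
  define b where "b = a + 2 ^ Suc k"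
  have hb: "h + 2 ^ k = b" "a < h" "h < b" "h < n" "b < n"
    using Suc.prems(2) by (auto simp: h_def b_def)
  obtain \<tau> c where \<tau>: "transmission_sequence n (\<sigma> @ \<tau>)" "phase a h \<sigma> \<tau> c"
      "occupies (run A (\<sigma> @ \<tau>)) (phase_active \<sigma> \<tau>) (real k / 2)"
    using Suc.IH[OF Suc.prems(1), of a] hb unfolding h_def by auto
  obtain \<upsilon> d where \<upsilon>: "transmission_sequence n (\<sigma> @ \<tau> @ \<upsilon>)" "phase h b (\<sigma> @ \<tau>) \<upsilon> d"
      "occupies (run A (\<sigma> @ \<tau> @ \<upsilon>)) (phase_active (\<sigma> @ \<tau>) \<upsilon>) (real k / 2)"
    using Suc.IH[OF \<tau>(1), of h] hb by auto
  define X where "X = phase_active \<sigma> \<tau>"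
  define Y where "Y = phase_active (\<sigma> @ \<tau>) \<upsilon>"
  define \<rho> where "\<rho> = \<sigma> @ \<tau> @ \<upsilon>"
  define m where "m = length \<rho>"
  define \<rho>' where "\<rho>' = \<rho> @ [Arrive a h 1]"
  \<comment> \<open>The algorithm is deterministic, so its reaction to the cover can be inspected
    before deciding whether the cover is really sent.\<close>
  define S where "S = run A \<rho>'"
  have XY: "phase_active \<sigma> (\<tau> @ \<upsilon>) = X \<union> Y" "X \<inter> Y = {}"
    using phase_active_two_phases[OF \<upsilon>(2)] by (auto simp: X_def Y_def)
  have fin: "finite X" "finite Y" by (auto simp: X_def Y_def phase_active_def)
  have ts': "transmission_sequence n \<rho>'"
    using \<upsilon>(1) hb by (simp add: \<rho>'_def \<rho>_def[symmetric] transmission_sequence_append1)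
  have val: "valid_schedule V n \<rho>' S"
    using alg ts' by (simp add: online_algorithm_def S_def)
  have act': "active \<rho>' (Suc m) = insert m (active \<rho> m)"
    using active_append_Arrive[of n \<rho>] \<upsilon>(1) by (simp add: \<rho>'_def m_def \<rho>_def[symmetric])
  have mX: "X \<union> Y \<subseteq> active \<rho> m" "m \<notin> active \<rho> m"
    using XY(1) by (auto simp: phase_active_def \<rho>_def m_def dest: active_less)
  then have sub: "X \<subseteq> active \<rho>' (Suc m) - {m}" "Y \<subseteq> active \<rho>' (Suc m) - {m}" "m \<in> active \<rho>' (Suc m)"
    using act' by auto
  \<comment> \<open>Being on-line, \<open>A\<close> reacts to earlier events independently of the
    continuation. Hence the occupancies from the two induction hypotheses carry over to
    \<open>S\<close>.\<close>
  have run_old: "S i = run A \<rho> i" if "i < m" for i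
    using that run_append by (simp add: S_def \<rho>'_def m_def)
  have "S i = run A (\<sigma> @ \<tau>) i" if "i \<in> X" for i
    using phase_activeD(2)[of i \<sigma> \<tau>] that run_append[of i "\<sigma> @ \<tau>"]
    by (simp add: S_def \<rho>'_def \<rho>_def X_def)
  then have occX: "occupies S X (real k / 2)"
    using \<tau>(3) occupies_cong[of X S] by (simp add: X_def)
  have "S i = run A \<rho> i" if "i \<in> X \<union> Y" for i
    using run_old mX(1) that active_less by blast
  then have occY: "occupies S Y (real k / 2)" and occ_cong: "occupies S (X \<union> Y) K = occupies (run A \<rho>) (X \<union> Y) K" for K
    using \<upsilon>(3) occupies_cong[of Y S "run A \<rho>"] occupies_cong[of "X \<union> Y" S "run A \<rho>"]
    by (auto simp: Y_def \<rho>_def)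
  define x where "x w = (\<Sum>i\<in>X. wave_load S i w)" for w
  define y where "y w = (\<Sum>i\<in>Y. wave_load S i w)" for w
  define z where "z w = wave_load S m w" for w
  obtain W where W: "finite W" "wave ` set (pieces (S m)) \<subseteq> W"
      "real k / 2 \<le> (\<Sum>w\<in>W. min 1 (x w))" "real k / 2 \<le> (\<Sum>w\<in>W. min 1 (y w))"
    using occupies_common_set[OF val _ _ _ occX occY, of "Suc m" "wave ` set (pieces (S m))"] sub
    unfolding x_def y_def by blast
  have "(\<Sum>p\<leftarrow>pieces (S m). bandwidth p) = 1"
    using valid_schedule_assignment[OF val sub(3)]
    by (simp add: valid_assignment_def \<rho>'_def m_def)
  \<comment> \<open>\<open>W\<close> contains every wavelength on which the cover has a piece, so
    its full bandwidth is counted even if it is split.\<close>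
  then have z1: "(\<Sum>w\<in>W. z w) = 1"
    using sum_list_by_wave[OF W(1,2)] by (simp add: z_def wave_load_def)
  have nonneg: "0 \<le> x w \<and> 0 \<le> y w \<and> 0 \<le> z w" for w
    using wave_load_nonneg[OF val] sub unfolding x_def y_def z_def
    by (metis (no_types, lifting) DiffD1 subsetD sum_nonneg)
  have shared: "z w + x w \<le> 1" if "0 < z w" for w
    unfolding x_def z_def
  proof (rule cover_shares_light_trails[OF val ts' _ sub(3) sub(1)])
    fix i assume i: "i \<in> X"
    then have "\<rho>' ! i = (\<sigma> @ \<tau>) ! i"
      using phase_activeD(2)[of i \<sigma> \<tau>] nth_append_left[of i "\<sigma> @ \<tau>" "\<upsilon> @ [Arrive a h 1]"]
      by (simp add: X_def \<rho>'_def \<rho>_def)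
    then show "source (\<rho>' ! m) \<le> source (\<rho>' ! i) \<and> destination (\<rho>' ! i) \<le> destination (\<rho>' ! m)"
      using phase_location[OF \<tau>(2)] phase_activeD[of i \<sigma> \<tau>] i by (simp add: X_def \<rho>'_def m_def)
  qed (use that in \<open>simp_all add: z_def \<rho>'_def m_def\<close>)
  have "real k / 2 + 1 / 2 \<le> (\<Sum>w\<in>W. min 1 (x w + y w)) \<or>
      real k / 2 + 1 / 2 \<le> (\<Sum>w\<in>W. min 1 (z w + y w))"
    using nonneg shared z1 W(3,4) by (intro potential_gain) auto
  then show ?case
  proof
    \<comment> \<open>Here the cover is not sent: the phase stops after \<open>\<upsilon>\<close>,
      and the bound is transferred from \<open>S\<close> to the run on
      \<open>\<rho>\<close>.\<close>
    assume gain: "real k / 2 + 1 / 2 \<le> (\<Sum>w\<in>W. min 1 (x w + y w))"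
    have "x w + y w = (\<Sum>i\<in>X \<union> Y. wave_load S i w)" for w
      unfolding x_def y_def using fin XY(2) by (rule sum.union_disjoint[symmetric])
    then have "occupies S (X \<union> Y) (real (Suc k) / 2)"
      unfolding occupies_def using gain W(1) by (intro exI[of _ W]) (simp add: add_divide_distrib)
    moreover obtain e where "phase a b \<sigma> (\<tau> @ \<upsilon>) e"
      using phase_keep_both[OF \<tau>(2) \<upsilon>(2)] hb by auto
    ultimately show ?thesis
      using \<upsilon>(1) XY(1) occ_cong unfolding b_def \<rho>_def by metis
  next
    assume gain: "real k / 2 + 1 / 2 \<le> (\<Sum>w\<in>W. min 1 (z w + y w))"
    obtain \<delta> e where \<delta>: "transmission_sequence n (\<sigma> @ \<tau> @ \<upsilon> @ Arrive a h 1 # \<delta>)"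
        "phase a b \<sigma> (\<tau> @ \<upsilon> @ Arrive a h 1 # \<delta>) e"
        "phase_active \<sigma> (\<tau> @ \<upsilon> @ Arrive a h 1 # \<delta>) = insert m Y"
      using phase_cover[OF \<tau>(2) \<upsilon>(2) hb(2) _ hb(4) \<upsilon>(1)] hb(3)
      unfolding m_def \<rho>_def Y_def by auto
    have "m \<notin> Y" using mX by auto
    then have "z w + y w = (\<Sum>i\<in>insert m Y. wave_load S i w)" for w
      using fin(2) by (simp add: y_def z_def)
    then have "occupies S (insert m Y) (real (Suc k) / 2)"
      unfolding occupies_def using gain W(1) by (intro exI[of _ W]) (simp add: add_divide_distrib)
    \<comment> \<open>The departures in \<open>\<delta>\<close> come after the assignment of all
      survivors and cannot change it.\<close>
    moreover have "S i = run A (\<rho>' @ \<delta>) i" if "i \<in> insert m Y" for i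
    proof -
      have "i < length \<rho>'" using that sub active_less_length by blast
      then show ?thesis by (simp add: S_def run_append)
    qed
    ultimately have "occupies (run A (\<rho>' @ \<delta>)) (insert m Y) (real (Suc k) / 2)"
      using occupies_cong by metis
    then show ?thesis
      using \<delta> unfolding b_def \<rho>'_def \<rho>_def by (intro exI[of _ "\<tau> @ \<upsilon> @ Arrive a h 1 # \<delta>"] exI[of _ e]) simp
  qed
qed

section \<open>From the adversary to the competitive ratio\<close>

lemma optimal_wavelengths_pos:
  assumes "valid_schedule V n \<sigma> S" and act: "active \<sigma> (length \<sigma>) \<noteq> {}"
    and ts: "transmission_sequence n \<sigma>"
  shows "0 < optimal_wavelengths V n \<sigma>"
proof -
  \<comment> \<open>The given schedule \<open>S\<close> shows that the \<open>LEAST\<close> ranges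
    over a nonempty set and is attained.\<close>
  obtain S' where S': "valid_schedule V n \<sigma> S'" "wavelengths_required \<sigma> S' = optimal_wavelengths V n \<sigma>"
    unfolding optimal_wavelengths_def
    using LeastI_ex[of "\<lambda>k. \<exists>S. valid_schedule V n \<sigma> S \<and> wavelengths_required \<sigma> S = k"] assms(1)
    by blast
  obtain i where i: "i \<in> active \<sigma> (length \<sigma>)" using act by blast
  \<comment> \<open>An empty list of pieces would have total bandwidth 0, but requirements are
    positive.\<close>
  have "pieces (S' i) \<noteq> []"
    using valid_schedule_assignment[OF S'(1) i]
      transmission_sequence_Arrive(3)[OF ts active_less_length[OF i] active_is_Arrive[OF i]]
    by (auto simp: valid_assignment_def)
  then have "wavelengths_in_use \<sigma> S' (length \<sigma>) \<noteq> {}"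
    using i by (auto simp: wavelengths_in_use_def)
  then have "0 < card (wavelengths_in_use \<sigma> S' (length \<sigma>))"
    by (auto simp: wavelengths_in_use_def card_gt_0_iff)
  also have "\<dots> \<le> wavelengths_required \<sigma> S'"
    unfolding wavelengths_required_def by (intro Max_ge) auto
  finally show ?thesis using S'(2) by simp
qed

lemma online_lower_bound:
  assumes alg: "online_algorithm V n A" and k: "0 < k" "2 ^ k < n"
  shows "\<exists>\<sigma>. transmission_sequence n \<sigma> \<and> 0 < optimal_wavelengths V n \<sigma> \<and>
    optimal_wavelengths V n \<sigma> \<le> 2 \<and> real k / 2 \<le> real (wavelengths_required \<sigma> (run A \<sigma>))"
proof -
  obtain \<sigma> c where \<sigma>: "transmission_sequence n \<sigma>" "phase 0 (2 ^ k) [] \<sigma> c"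
      "occupies (run A \<sigma>) (active \<sigma> (length \<sigma>)) (real k / 2)"
    using adversary[OF alg, of "[]" 0 k] k(2)
    by (auto simp: transmission_sequence_def phase_active_def)
  \<comment> \<open>The two truth values become the wavelengths 0 and 1; with an empty history the
    phase colouring covers the whole sequence.\<close>
  have "proper_colouring \<sigma> 0 (of_bool \<circ> c :: nat \<Rightarrow> nat)"
    using \<sigma>(2) by (auto simp: phase_def proper_colouring_def)
  then have "optimal_wavelengths V n \<sigma> \<le> 2"
    using \<sigma>(1) k(2) by (intro optimal_wavelengths_le_colours) auto
  moreover have use: "real k / 2 \<le> real (card (wavelengths_in_use \<sigma> (run A \<sigma>) (length \<sigma>)))"
    using occupies_le_card[OF \<sigma>(3)] .
  moreover have "card (wavelengths_in_use \<sigma> (run A \<sigma>) (length \<sigma>)) \<le> wavelengths_required \<sigma> (run A \<sigma>)"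
    unfolding wavelengths_required_def by (intro Max_ge) auto
  \<comment> \<open>As \<open>k\<close> is positive, some wavelength is still in use at the
    end.\<close>
  moreover have "active \<sigma> (length \<sigma>) \<noteq> {}"
    using use k(1) by (auto simp: wavelengths_in_use_def)
  then have "0 < optimal_wavelengths V n \<sigma>"
    using alg \<sigma>(1) unfolding online_algorithm_def by (blast intro: optimal_wavelengths_pos)
  ultimately show ?thesis using \<sigma>(1) by (intro exI[of _ \<sigma>]) linarith
qed

theorem theorem10:
  "\<exists>c::real. c > 0 \<and>
     (\<forall>\<^sub>F n in sequentially. \<forall>V A. online_algorithm V n A \<longrightarrow>
        (\<exists>\<sigma>. transmission_sequence n \<sigma> \<and>
             optimal_wavelengths V n \<sigma> > 0 \<and>
             real (wavelengths_required \<sigma> (run A \<sigma>))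
               \<ge> c * ln (real n) * real (optimal_wavelengths V n \<sigma>)))"
proof (intro exI[of _ "1/8"] conjI eventually_sequentiallyI[of 3] allI impI)
  fix n V A assume n: "3 \<le> (n::nat)" and alg: "online_algorithm V n A"
  \<comment> \<open>The inequality is strict on the left because the region from 0 to
    \<open>2 ^ k\<close> has \<open>2 ^ k + 1\<close> nodes. From \<open>n \<ge> 3\<close> follows
    \<open>k > 0\<close>, which also gives \<open>Suc k \<le> 2 * k\<close> below.\<close>
  obtain k where k: "2 ^ k < n" "n \<le> 2 ^ Suc k"
    using ex_power_ivl2[of 2 n] n by auto
  have "0 < k" using k(2) n by (cases k) auto
  obtain \<sigma> where \<sigma>: "transmission_sequence n \<sigma>" "0 < optimal_wavelengths V n \<sigma>"
      "optimal_wavelengths V n \<sigma> \<le> 2" "real k / 2 \<le> real (wavelengths_required \<sigma> (run A \<sigma>))"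
    using online_lower_bound[OF alg \<open>0 < k\<close> k(1)] by blast
  have "real n \<le> 2 ^ Suc k" using k(2) by (metis of_nat_le_iff of_nat_numeral of_nat_power)
  then have "ln (real n) \<le> ln (2 ^ Suc k)" using n by (subst ln_le_cancel_iff) auto
  also have "\<dots> = real (Suc k) * ln 2" by (rule ln_realpow)
  also have "\<dots> \<le> real (Suc k) * 1" using ln_2_less_1 by (intro mult_left_mono) auto
  also have "\<dots> \<le> 2 * real k" using \<open>0 < k\<close> by simp
  \<comment> \<open>The constant 1/8 is chosen so that the factor 2 from
    \<open>ln (real n) \<le> 2 * real k\<close> and the two off-line wavelengths leave exactly
    \<open>real k / 2\<close>.\<close>
  finally have "1/8 * ln (real n) * real (optimal_wavelengths V n \<sigma>) \<le> 1/8 * (2 * real k) * 2"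
    using \<sigma>(3) n by (intro mult_mono) auto
  also have "\<dots> \<le> real (wavelengths_required \<sigma> (run A \<sigma>))" using \<sigma>(4) by simp
  finally show "\<exists>\<sigma>. transmission_sequence n \<sigma> \<and> optimal_wavelengths V n \<sigma> > 0 \<and>
      real (wavelengths_required \<sigma> (run A \<sigma>)) \<ge> 1/8 * ln (real n) * real (optimal_wavelengths V n \<sigma>)"
    using \<sigma>(1,2) by blast
qed simp

end
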